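(* Let $p\ge 2$ be an integer, let $s>p-2$, and let $A\subset\mathbb R^p$ be a nonempty compact set such that $\mathcal P_s^*(A,N)<+\infty$ for every $N\in\mathbb N$. If $(\omega_N^* )_{N\in\mathbb N}$ is a sequence of $N$-point multisets in $\mathbb R^p$ with $P_s(A,\omega_N^* )=\mathcal P_s^*(A,N)$ for every $N$, then any weak-$*$ cluster point of the sequence $$\nu(\omega_N^* ):=\frac1N\sum_{x\in\omega_N^*}\delta_x,\qquad N=1,2,3,\ldots,$$ is a probability measure supported on $A$.
   Context: Configurations are $N$-point multisets (points may be repeated, and sums over a multiset count repetitions). For $s>0$, $K_s(x,y):=|x-y|^{-s}$ with $K_s(x,x)=+\infty$. For nonempty $A\subset\mathbb R^p$, $$P_s(A,\omega_N):=\inf_{y\in A}\sum_{i=1}^N K_s(x_i,y),\qquad \mathcal P_s^*(A,N):=\sup_{\omega_N\subset\mathbb R^p}P_s(A,\omega_N),$$ the supremum being over $N$-point multisets in $\mathbb R^p$. $\delta_x$ is the unit point mass at $x$. *)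

theory Defs
  imports "HOL-Probability.Probability"
begin

definition riesz_kernel :: "real \<Rightarrow> 'a::euclidean_space \<Rightarrow> 'a \<Rightarrow> ennreal" where
  "riesz_kernel s x y = (if x = y then \<infinity> else ennreal (norm (x - y) powr (- s)))"

definition polarization :: "real \<Rightarrow> 'a::euclidean_space set \<Rightarrow> 'a multiset \<Rightarrow> ennreal" where
  "polarization s A \<omega> = (INF y\<in>A. \<Sum>x\<in>#\<omega>. riesz_kernel s x y)"

definition max_polarization :: "real \<Rightarrow> 'a::euclidean_space set \<Rightarrow> nat \<Rightarrow> ennreal" where
  "max_polarization s A N = (SUP \<omega>\<in>{\<omega>. size \<omega> = N}. polarization s A \<omega>)"

definition normalized_counting_measure :: "'a::euclidean_space multiset \<Rightarrow> 'a measure" where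
  "normalized_counting_measure \<omega> =
     measure_of UNIV (sets borel)
       (\<lambda>B. (\<Sum>x\<in>#\<omega>. emeasure (return borel x) B) / of_nat (size \<omega>))"

lemma sets_normalized_counting_measure [simp]:
  "sets (normalized_counting_measure \<omega>) = sets borel"
  by (simp add: normalized_counting_measure_def)
    (metis sets.sigma_sets_eq space_borel)

lemma emeasure_normalized_counting_measure:
  assumes "B \<in> sets borel"
  shows "emeasure (normalized_counting_measure \<omega>) B =
           (\<Sum>x\<in>#\<omega>. emeasure (return borel x) B) / of_nat (size \<omega>)"
proof (rule emeasure_measure_of[OF normalized_counting_measure_def])
  show "positive (sets (normalized_counting_measure \<omega>))
          (\<lambda>B. (\<Sum>x\<in>#\<omega>. emeasure (return borel x) B) / of_nat (size \<omega>))"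
    by (simp add: positive_def)
  have "(\<Sum>i. \<Sum>x\<in>#\<omega>. emeasure (return borel x) (F i)) = (\<Sum>x\<in>#\<omega>. emeasure (return borel x) (\<Union>i. F i))"
    if "range F \<subseteq> sets borel" "disjoint_family F" for F :: "nat \<Rightarrow> 'a set"
  proof (induction \<omega>)
    case (add x \<omega>)
    have "(\<Sum>i. emeasure (return borel x) (F i)) = emeasure (return borel x) (\<Union>i. F i)"
      using that by (intro suminf_emeasure) auto
    with add show ?case
      by (simp add: suminf_add[symmetric])
  qed simp
  then show "countably_additive (sets (normalized_counting_measure \<omega>))
          (\<lambda>B. (\<Sum>x\<in>#\<omega>. emeasure (return borel x) B) / of_nat (size \<omega>))"
    by (auto simp: countably_additive_def divide_ennreal_def ennreal_suminf_multc)
qed (use assms in auto)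

definition compactly_supported_continuous :: "('a::euclidean_space \<Rightarrow> real) set" where
  "compactly_supported_continuous =
     {f. continuous_on UNIV f \<and> compact (closure {x. f x \<noteq> 0})}"

text \<open>In Euclidean space the positive Radon measures are exactly the Borel measures
  that are finite on compact sets.\<close>

definition radon_measures :: "'a::euclidean_space measure set" where
  "radon_measures =
     {\<mu>. sets \<mu> = sets borel \<and> (\<forall>K. compact K \<longrightarrow> emeasure \<mu> K < \<infinity>)}"

text \<open>The topology of pointwise convergence of the functionals that integrate a compactly
  supported continuous function.  Total mass is not continuous for it, so a limit of
  probability measures may lose mass at infinity.\<close>

definition weak_star_topology :: "'a::euclidean_space measure topology" where
  "weak_star_topology =
     pullback_topology radon_measures
       (\<lambda>\<mu>. \<lambda>f\<in>compactly_supported_continuous. \<integral>x. f x \<partial>\<mu>)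
       (product_topology (\<lambda>_. euclideanreal) compactly_supported_continuous)"

lemma topspace_weak_star_topology [simp]: "topspace weak_star_topology = radon_measures"
  by (auto simp: weak_star_topology_def topspace_pullback_topology)

definition cluster_point_in :: "'b topology \<Rightarrow> (nat \<Rightarrow> 'b) \<Rightarrow> 'b \<Rightarrow> bool" where
  "cluster_point_in T X l \<longleftrightarrow>
     l \<in> topspace T \<and> (\<forall>U. openin T U \<and> l \<in> U \<longrightarrow> (\<exists>\<^sub>F n in sequentially. X n \<in> U))"

end

theory Submission
  imports Defs "HOL-Real_Asymp.Real_Asymp"
begin

text \<open>For \<open>s > p - 2\<close> the kernel \<open>|x|\<^sup>-\<^sup>s\<close> is strictly subharmonic away from the origin. Hence, if
  \<open>2 p\<close> points of a configuration lie very close to a point \<open>x\<^sub>0\<close> off \<open>A\<close>, moving them to the vertices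
  \<open>x\<^sub>0 \<plusminus> r e\<^sub>i\<close> of a small cross-polytope raises the potential on all of \<open>A\<close> by a fixed positive
  amount, so the configuration is not optimal. By a covering argument, a compact set disjoint from
  \<open>A\<close> contains a number of points of an optimal configuration that is bounded independently of
  \<open>N\<close>, and carries no mass in the limit. No mass escapes to infinity either: if \<open>A\<close> lies in the ball of
  radius \<open>R\<close> about the origin, replacing a point of norm greater than \<open>3 R\<close> by the origin raises the
  potential uniformly on \<open>A\<close>.\<close>

section \<open>Quadratic minorants of negative powers\<close>

text \<open>The second Taylor coefficient at 0 is \<open>a * (a + 1) / 2\<close>; taking
  \<open>q\<close> strictly below it leaves room for the remainder on a small symmetric
  interval.\<close>

lemma neg_powr_quadratic_lower_bound:
  fixes a q :: real
  assumes a: "a > 0" and q: "q < a * (a + 1) / 2"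
  obtains \<delta> where "0 < \<delta>" "\<delta> < 1"
    "\<And>v. \<bar>v\<bar> \<le> \<delta> \<Longrightarrow> 1 - a * v + q * v\<^sup>2 \<le> (1 + v) powr (- a)"
proof -
  \<comment> \<open>As \<open>d\<close> tends to 0 this lower bound for the Lagrange coefficient on
    \<open>[-d, d]\<close> tends to \<open>a * (a + 1) / 2 > q\<close>, which fixes the choice of
    \<open>\<delta>\<close>.\<close>
  have "((\<lambda>d. a * (a + 1) / 2 * (1 + d) powr (- a - 2)) \<longlongrightarrow> a * (a + 1) / 2 * (1 + 0) powr (- a - 2)) (at_right 0)"
    by (intro tendsto_intros) auto
  then have "eventually (\<lambda>d. q < a * (a + 1) / 2 * (1 + d) powr (- a - 2)) (at_right 0)"
    using q by (intro order_tendstoD(1)[where a = q]) auto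
  moreover have "eventually (\<lambda>d::real. d \<in> {0<..<1}) (at_right 0)"
    by (rule eventually_at_right_real) simp
  ultimately have "eventually (\<lambda>d. q < a * (a + 1) / 2 * (1 + d) powr (- a - 2) \<and> d \<in> {0<..<1}) (at_right 0)"
    by (rule eventually_conj)
  then obtain \<delta> where \<delta>: "q < a * (a + 1) / 2 * (1 + \<delta>) powr (- a - 2)" "0 < \<delta>" "\<delta> < 1"
    by (metis (no_types, lifting) eventually_happens' greaterThanLessThan_iff trivial_limit_at_right_real)
  have "1 - a * v + q * v\<^sup>2 \<le> (1 + v) powr (- a)" if v: "\<bar>v\<bar> \<le> \<delta>" for v
  proof (cases "v = 0")
    case False
    \<comment> \<open>The function and its first two derivatives, indexed as \<open>Taylor\<close>
      expects; only indices up to 2 matter in an expansion of order 2.\<close>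
    define D where "D = (\<lambda>m::nat. \<lambda>t::real. if m = 0 then (1 + t) powr (- a)
      else if m = 1 then - a * (1 + t) powr (- a - 1) else a * (a + 1) * (1 + t) powr (- a - 2))"
    have "DERIV (D m) t :> D (Suc m) t" if "m < 2" "- \<delta> \<le> t" for m t
    proof -
      have t: "0 < 1 + t" using that \<delta> by simp
      consider "m = 0" | "m = 1" using \<open>m < 2\<close> by linarith
      then show ?thesis
        by cases (use t in \<open>auto simp: D_def algebra_simps intro!: derivative_eq_intros\<close>)
    qed
    then have "\<forall>m t. m < 2 \<and> - \<delta> \<le> t \<and> t \<le> \<delta> \<longrightarrow> DERIV (D m) t :> D (Suc m) t"
      by blast
    then have "\<exists>t. (if v < 0 then v < t \<and> t < 0 else 0 < t \<and> t < v) \<and>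
        (1 + v) powr (- a) = (\<Sum>m<2. D m 0 / fact m * (v - 0) ^ m) + D 2 t / fact 2 * (v - 0)\<^sup>2"
      using \<open>v \<noteq> 0\<close> v \<delta>
      by (intro Taylor[where a = "- \<delta>" and b = \<delta>]) (auto simp: D_def)
    then obtain t where t: "if v < 0 then v < t \<and> t < 0 else 0 < t \<and> t < v"
      and eq: "(1 + v) powr (- a) = (\<Sum>m<2. D m 0 / fact m * (v - 0) ^ m) + D 2 t / fact 2 * (v - 0)\<^sup>2"
      by blast
    \<comment> \<open>The exponent is negative, so the second derivative is smallest at the right
      end \<open>\<delta>\<close>.\<close>
    have "(1 + \<delta>) powr (- a - 2) \<le> (1 + t) powr (- a - 2)"
      using t v \<delta> a by (intro powr_mono2') (auto split: if_splits)
    then have "a * (a + 1) / 2 * (1 + \<delta>) powr (- a - 2) \<le> a * (a + 1) / 2 * (1 + t) powr (- a - 2)"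
      using a by (intro mult_left_mono) auto
    then have "q \<le> a * (a + 1) / 2 * (1 + t) powr (- a - 2)"
      using \<delta> by linarith
    then have "q * v\<^sup>2 \<le> a * (a + 1) / 2 * (1 + t) powr (- a - 2) * v\<^sup>2"
      by (rule mult_right_mono) simp
    then show ?thesis
      unfolding eq by (simp add: D_def lessThan_nat_numeral lessThan_Suc numeral_2_eq_2)
  qed simp
  with \<delta> that show thesis by blast
qed

section \<open>Counting measures and weak-star cluster points\<close>

lemma sum_mset_image_eq_sum_count:
  fixes f :: "'a \<Rightarrow> 'b::comm_semiring_1"
  assumes "finite S" "set_mset M \<subseteq> S"
  shows "(\<Sum>x\<in>#M. f x) = (\<Sum>x\<in>S. of_nat (count M x) * f x)"
  using assms(2)
proof (induction M)
  case (add x M)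
  have "(\<Sum>y\<in>S. of_nat (count (add_mset x M) y) * f y)
      = (\<Sum>y\<in>S. (if y = x then f y else 0) + of_nat (count M y) * f y)"
    by (intro sum.cong) (auto simp: algebra_simps)
  with add assms(1) show ?case
    by (simp add: sum.distrib)
qed simp

text \<open>The identity map only replaces the discrete sigma-algebra of the pmf by the Borel one.
  Integrals thereby become finite sums weighted by multiplicity.\<close>

lemma normalized_counting_measure_eq_distr:
  fixes \<omega> :: "'a::euclidean_space multiset"
  assumes "\<omega> \<noteq> {#}"
  shows "normalized_counting_measure \<omega> = distr (measure_pmf (pmf_of_multiset \<omega>)) borel (\<lambda>x. x)"
proof (rule measure_eqI)
  fix B assume "B \<in> sets (normalized_counting_measure \<omega>)"
  then have B: "B \<in> sets borel" by simp
  have div: "ennreal (real k / real (size \<omega>)) = of_nat k / of_nat (size \<omega>)" for k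
    using assms by (simp add: divide_ennreal[symmetric] ennreal_of_nat_eq_real_of_nat nonempty_has_size)
  have "emeasure (measure_pmf (pmf_of_multiset \<omega>)) B = (\<integral>\<^sup>+x. indicator B x \<partial>measure_pmf (pmf_of_multiset \<omega>))"
    by simp
  also have "\<dots> = (\<Sum>x\<in>set_mset \<omega>. indicator B x * ennreal (real (count \<omega> x) / real (size \<omega>)))"
    using assms by (subst nn_integral_measure_pmf_finite) auto
  also have "\<dots> = (\<Sum>x\<in>set_mset \<omega>. of_nat (count \<omega> x) * indicator B x) / of_nat (size \<omega>)"
    unfolding div by (simp add: divide_ennreal_def sum_distrib_left mult_ac)
  also have "\<dots> = (\<Sum>x\<in>#\<omega>. indicator B x) / of_nat (size \<omega>)"
    by (subst sum_mset_image_eq_sum_count[of "set_mset \<omega>"]) auto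
  finally show "emeasure (normalized_counting_measure \<omega>) B =
      emeasure (distr (measure_pmf (pmf_of_multiset \<omega>)) borel (\<lambda>x. x)) B"
    using B by (simp add: emeasure_normalized_counting_measure emeasure_distr)
qed simp

lemma integral_normalized_counting_measure:
  fixes \<omega> :: "'a::euclidean_space multiset" and f :: "'a \<Rightarrow> real"
  assumes "\<omega> \<noteq> {#}" and "f \<in> borel_measurable borel"
  shows "(\<integral>x. f x \<partial>normalized_counting_measure \<omega>) = (\<Sum>x\<in>#\<omega>. f x) / size \<omega>"
proof -
  have "(\<integral>x. f x \<partial>normalized_counting_measure \<omega>) = (\<integral>x. f x \<partial>measure_pmf (pmf_of_multiset \<omega>))"
    using assms by (simp add: normalized_counting_measure_eq_distr integral_distr)
  also have "\<dots> = (\<Sum>x\<in>set_mset \<omega>. f x * (count \<omega> x / size \<omega>))"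
    using assms by (subst integral_measure_pmf_real[where A = "set_mset \<omega>"]) auto
  also have "\<dots> = (\<Sum>x\<in>#\<omega>. f x) / size \<omega>"
    by (subst sum_mset_image_eq_sum_count[of "set_mset \<omega>"])
      (auto simp: sum_divide_distrib mult_ac)
  finally show ?thesis .
qed

text \<open>Integration against \<open>f\<close> is weak-star continuous, so it sends cluster points
  to cluster points, and a convergent real sequence has no cluster point but its limit.\<close>

lemma cluster_point_in_weak_star_integral:
  fixes \<mu> :: "'a::euclidean_space measure"
  assumes cl: "cluster_point_in weak_star_topology \<nu> \<mu>"
    and f: "f \<in> compactly_supported_continuous"
    and lim: "(\<lambda>n. \<integral>x. f x \<partial>\<nu> n) \<longlonglongrightarrow> l"
  shows "(\<integral>x. f x \<partial>\<mu>) = l"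
proof (rule ccontr)
  assume "(\<integral>x. f x \<partial>\<mu>) \<noteq> l"
  then obtain V W where VW: "open V" "open W" "(\<integral>x. f x \<partial>\<mu>) \<in> V" "l \<in> W" "V \<inter> W = {}"
    by (meson hausdorff)
  define P where "P = product_topology (\<lambda>_. euclideanreal) (compactly_supported_continuous :: ('a \<Rightarrow> real) set)"
  have P: "openin P {u \<in> topspace P. u f \<in> V}"
    unfolding P_def using f VW(1)
    by (intro openin_continuous_map_preimage[OF continuous_map_product_coordinates]) auto
  \<comment> \<open>The subbasic weak-star neighbourhood of \<open>\<mu>\<close> cut out by the
    single coordinate \<open>f\<close>.\<close>
  define U where "U = (\<lambda>\<mu>. \<lambda>f\<in>compactly_supported_continuous. \<integral>x. f x \<partial>\<mu>) -` {u \<in> topspace P. u f \<in> V} \<inter> radon_measures"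
  have "openin weak_star_topology U"
    using P unfolding weak_star_topology_def openin_pullback_topology U_def P_def by blast
  moreover have U_iff: "M \<in> U \<longleftrightarrow> M \<in> radon_measures \<and> (\<integral>x. f x \<partial>M) \<in> V" for M
    using f by (auto simp: U_def P_def)
  moreover have "\<mu> \<in> radon_measures"
    using cl by (simp add: cluster_point_in_def)
  ultimately have "\<exists>\<^sub>F n in sequentially. \<nu> n \<in> U"
    using cl VW(3) unfolding cluster_point_in_def by blast
  moreover have "\<forall>\<^sub>F n in sequentially. (\<integral>x. f x \<partial>\<nu> n) \<in> W"
    using lim VW by (auto dest: topological_tendstoD)
  ultimately have "\<exists>\<^sub>F n in sequentially. (\<integral>x. f x \<partial>\<nu> n) \<in> W \<and> \<nu> n \<in> U"
    by (rule frequently_eventually_conj)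
  then show False
    using VW(5) U_iff by (auto dest: frequently_ex)
qed

lemma integrable_compactly_supported_continuous:
  fixes \<mu> :: "'a::euclidean_space measure"
  assumes "\<mu> \<in> radon_measures" "f \<in> compactly_supported_continuous"
  shows "integrable \<mu> f"
proof -
  define K where "K = closure {x. f x \<noteq> 0}"
  have K: "compact K" and f: "continuous_on UNIV f"
    using assms(2) by (auto simp: compactly_supported_continuous_def K_def)
  have sets: "sets \<mu> = sets borel" and fin: "emeasure \<mu> K < \<infinity>"
    using assms(1) K by (auto simp: radon_measures_def)
  have "bounded (f ` K)"
    using K f by (intro compact_imp_bounded compact_continuous_image) (auto intro: continuous_on_subset)
  then obtain B where B: "\<And>x. x \<in> K \<Longrightarrow> norm (f x) \<le> B"
    by (auto simp: bounded_iff)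
  have "f \<in> borel_measurable \<mu>"
    using borel_measurable_continuous_onI[OF f] sets measurable_cong_sets by blast
  then show ?thesis
    using B fin K sets closure_subset[of "{x. f x \<noteq> 0}"]
    by (intro integrableI_bounded_set[where A = K and B = B]) (auto simp: K_def)
qed

section \<open>Exchanging points of an optimal configuration\<close>

text \<open>Since the gain \<open>c\<close> is the same for every \<open>y\<close>, it survives the
  infimum over \<open>A\<close>: replacing \<open>\<sigma>\<close> by \<open>\<tau>\<close> would
  beat the maximum for the same number of points.\<close>

lemma polarization_exchange:
  assumes sub: "\<sigma> \<subseteq># \<omega>" and sz: "size \<tau> = size \<sigma>"
    and fin: "max_polarization s A (size \<omega>) < \<infinity>"
    and opt: "polarization s A \<omega> = max_polarization s A (size \<omega>)"
    and c: "c > 0"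
    and le: "\<And>y. y \<in> A \<Longrightarrow> (\<Sum>x\<in>#\<sigma>. riesz_kernel s x y) + c \<le> (\<Sum>x\<in>#\<tau>. riesz_kernel s x y)"
  shows False
proof -
  let ?\<omega>' = "\<omega> - \<sigma> + \<tau>"
  have "polarization s A \<omega> + c \<le> polarization s A ?\<omega>'"
    unfolding polarization_def[of s A ?\<omega>']
  proof (rule INF_greatest)
    fix y assume y: "y \<in> A"
    have "polarization s A \<omega> + c \<le> (\<Sum>x\<in>#\<omega>. riesz_kernel s x y) + c"
      unfolding polarization_def using y by (intro add_right_mono INF_lower)
    also have "\<dots> = (\<Sum>x\<in>#\<omega> - \<sigma> + \<sigma>. riesz_kernel s x y) + c"
      using sub by (simp only: subset_mset.diff_add)
    also have "\<dots> = (\<Sum>x\<in>#\<omega> - \<sigma>. riesz_kernel s x y) + ((\<Sum>x\<in>#\<sigma>. riesz_kernel s x y) + c)"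
      by (simp add: add.assoc)
    also have "\<dots> \<le> (\<Sum>x\<in>#?\<omega>'. riesz_kernel s x y)"
      using le[OF y] by (simp add: add_left_mono)
    finally show "polarization s A \<omega> + c \<le> (\<Sum>x\<in>#?\<omega>'. riesz_kernel s x y)" .
  qed
  also have "\<dots> \<le> max_polarization s A (size \<omega>)"
    unfolding max_polarization_def using sz size_mset_mono[OF sub]
    by (intro SUP_upper) (simp add: size_Diff_submset[OF sub] del: subset_mset.diff_add_assoc2)
  finally have "polarization s A \<omega> + c \<le> polarization s A \<omega>"
    by (simp add: opt)
  \<comment> \<open>In \<open>ennreal\<close> the common term cancels only because it is
    finite.\<close>
  then show False
    using c fin opt by (metis ennreal_add_left_cancel_le add.right_neutral infinity_ennreal_def less_irrefl not_le)
qed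

lemma optimal_points_bounded:
  fixes A :: "'a::euclidean_space set"
  assumes s: "s > 0" and R: "R > 0" and A: "\<And>y. y \<in> A \<Longrightarrow> norm y \<le> R"
    and fin: "max_polarization s A (size \<omega>) < \<infinity>"
    and opt: "polarization s A \<omega> = max_polarization s A (size \<omega>)"
    and x: "x \<in># \<omega>"
  shows "norm x \<le> 3 * R"
proof (rule ccontr)
  assume far: "\<not> norm x \<le> 3 * R"
  \<comment> \<open>A point beyond \<open>3 * R\<close> is at distance at least \<open>2 * R\<close>
    from \<open>A\<close>, while the origin is at distance at most \<open>R\<close>;
    \<open>c\<close> is the resulting gap between kernel values.\<close>
  define c where "c = R powr (- s) - (2 * R) powr (- s)"
  have c: "0 < c"
    unfolding c_def using s R powr_less_mono2_neg[of "- s" R "2 * R"] by simp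
  have "(\<Sum>x\<in>#{#x#}. riesz_kernel s x y) + ennreal c \<le> (\<Sum>x\<in>#{#0#}. riesz_kernel s x y)" if "y \<in> A" for y
  proof -
    have y: "norm y \<le> R" using A that .
    have xy: "2 * R \<le> norm (x - y)"
      using norm_triangle_ineq2[of x y] y far by linarith
    then have "x \<noteq> y" using R by auto
    have "norm (x - y) powr (- s) \<le> (2 * R) powr (- s)"
      using xy s R by (intro powr_mono2') auto
    then have "ennreal (norm (x - y) powr (- s)) + ennreal c \<le> ennreal (R powr (- s))"
      using c by (simp add: ennreal_plus[symmetric] c_def ennreal_leI del: ennreal_plus)
    also have "ennreal (R powr (- s)) \<le> riesz_kernel s 0 y"
    proof (cases "y = 0")
      case False
      then have "R powr (- s) \<le> norm y powr (- s)"
        using y s by (intro powr_mono2') auto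
      with False show ?thesis by (simp add: riesz_kernel_def ennreal_leI)
    qed (simp add: riesz_kernel_def)
    finally show ?thesis
      using \<open>x \<noteq> y\<close> by (simp add: riesz_kernel_def)
  qed
  then show False
    using polarization_exchange[of "{#x#}" \<omega> "{#0#}" s A "ennreal c"] x fin opt c by simp
qed

text \<open>The term linear in \<open>r\<close> cancels between opposite vertices; with \<open>q\<close> close to \<open>a (a + 1) / 2\<close>,
  the coefficient \<open>8 q - 2 a p\<close> is close to \<open>s (s + 2 - p)\<close> for \<open>s = 2 a\<close>, which is the Laplacian of
  \<open>|x|\<^sup>-\<^sup>s\<close> on the unit sphere.\<close>

lemma cross_polytope_gain:
  fixes z :: "'a::euclidean_space" and a q r \<delta> :: real
  assumes low: "\<And>v. \<bar>v\<bar> \<le> \<delta> \<Longrightarrow> 1 - a * v + q * v\<^sup>2 \<le> (1 + v) powr (- a)"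
    and q: "q \<ge> 0" and r: "0 < r" "r \<le> norm z" "3 * r \<le> \<delta> * norm z"
  shows "norm z powr (- (2 * a)) * (2 * real DIM('a) + (8 * q - 2 * a * DIM('a)) * (r / norm z)\<^sup>2)
    \<le> (\<Sum>b\<in>Basis. norm (z + r *\<^sub>R b) powr (- (2 * a)) + norm (z - r *\<^sub>R b) powr (- (2 * a)))"
proof -
  \<comment> \<open>With the relative radius \<open>\<rho>\<close> and the direction cosines
    \<open>w b\<close>, the squared distance to a vertex is the square of \<open>norm z\<close>
    times 1 plus a small perturbation.\<close>
  define \<rho> where "\<rho> = r / norm z"
  define w where "w = (\<lambda>b. (z \<bullet> b) / norm z)"
  have z: "norm z > 0" using r by linarith
  have \<rho>: "0 < \<rho>" "\<rho> \<le> 1" "3 * \<rho> \<le> \<delta>"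
    using r z by (auto simp: \<rho>_def field_simps)
  \<comment> \<open>Squared distances are polynomial in \<open>r\<close>, so the exponent is halved
    from \<open>2 * a\<close> to \<open>a\<close>.\<close>
  have powr_sq: "t powr (- (2 * a)) = (t\<^sup>2) powr (- a)" if "t \<ge> 0" for t :: real
    using that by (cases "t = 0") (simp_all add: powr_powr flip: powr_numeral)
  \<comment> \<open>The sign \<open>k\<close> distinguishes the two opposite vertices.\<close>
  have expand: "norm (z + (k * r) *\<^sub>R b) powr (- (2 * a)) = norm z powr (- (2 * a)) * (1 + (\<rho>\<^sup>2 + 2 * k * \<rho> * w b)) powr (- a)"
    if "b \<in> Basis" "k \<in> {-1, 1}" for b and k :: real
  proof -
    have "(norm (z + (k * r) *\<^sub>R b))\<^sup>2 = (norm z)\<^sup>2 + r\<^sup>2 + 2 * k * r * (z \<bullet> b)"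
      unfolding power2_norm_eq_inner using that
      by (auto simp: inner_add inner_commute algebra_simps power2_eq_square inner_diff)
    also have "\<dots> = (norm z)\<^sup>2 * (1 + (\<rho>\<^sup>2 + 2 * k * \<rho> * w b))"
      using z by (simp add: \<rho>_def w_def field_simps power2_eq_square)
    finally have eq: "(norm (z + (k * r) *\<^sub>R b))\<^sup>2 = (norm z)\<^sup>2 * (1 + (\<rho>\<^sup>2 + 2 * k * \<rho> * w b))" .
    then have "0 \<le> (norm z)\<^sup>2 * (1 + (\<rho>\<^sup>2 + 2 * k * \<rho> * w b))"
      by (metis zero_le_power2)
    then have "0 \<le> 1 + (\<rho>\<^sup>2 + 2 * k * \<rho> * w b)"
      using z by (simp add: zero_le_mult_iff)
    then show ?thesis
      by (simp add: powr_sq eq powr_mult)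
  qed
  have w_le: "\<bar>w b\<bar> \<le> 1" if "b \<in> Basis" for b
    using Basis_le_norm[OF that, of z] z by (simp add: w_def)
  \<comment> \<open>The perturbation is at most \<open>3 * \<rho>\<close> in absolute value, which
    explains the factor 3 in the hypothesis on \<open>r\<close>.\<close>
  have v_le: "\<bar>\<rho>\<^sup>2 + 2 * k * \<rho> * w b\<bar> \<le> \<delta>" if "b \<in> Basis" "k \<in> {-1, 1}" for b and k :: real
  proof -
    have "\<bar>2 * k * \<rho> * w b\<bar> \<le> 2 * \<rho> * 1"
      using w_le[OF that(1)] that(2) \<rho> by (auto simp: abs_mult)
    moreover have "\<rho>\<^sup>2 \<le> \<rho>"
      using \<rho> by (simp add: power2_eq_square mult_left_le)
    ultimately show ?thesis
      using \<rho>(3) abs_triangle_ineq[of "\<rho>\<^sup>2" "2 * k * \<rho> * w b"] by simp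
  qed
  \<comment> \<open>By Parseval the quadratic terms contribute \<open>8 * q\<close> in total,
    independently of the direction of \<open>z\<close>, whereas the linear minorant costs
    \<open>2 * a\<close> per basis vector.\<close>
  have "(\<Sum>b\<in>Basis. (w b)\<^sup>2) = 1"
  proof -
    have "(\<Sum>b\<in>Basis. (w b)\<^sup>2) = (\<Sum>b\<in>Basis. (z \<bullet> b)\<^sup>2) / (norm z)\<^sup>2"
      by (simp add: w_def power_divide sum_divide_distrib)
    also have "(\<Sum>b\<in>Basis. (z \<bullet> b)\<^sup>2) = (norm z)\<^sup>2"
      unfolding power2_norm_eq_inner by (subst euclidean_inner) (simp add: power2_eq_square)
    finally show ?thesis using z by simp
  qed
  then have "2 * real DIM('a) + (8 * q - 2 * a * DIM('a)) * \<rho>\<^sup>2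
      = (\<Sum>b\<in>(Basis::'a set). 2 - 2 * a * \<rho>\<^sup>2 + 8 * q * \<rho>\<^sup>2 * (w b)\<^sup>2)"
    by (simp add: sum.distrib sum_subtractf flip: sum_distrib_left) (simp add: algebra_simps)
  also have "\<dots> \<le> (\<Sum>b\<in>Basis. (1 + (\<rho>\<^sup>2 + 2 * 1 * \<rho> * w b)) powr (- a) + (1 + (\<rho>\<^sup>2 + 2 * (-1) * \<rho> * w b)) powr (- a))"
  proof (rule sum_mono)
    fix b :: 'a assume b: "b \<in> Basis"
    \<comment> \<open>Adding the minorants of opposite vertices cancels the odd terms; the
      fourth-order term in \<open>\<rho>\<close> is dropped by means of
      \<open>q \<ge> 0\<close>.\<close>
    have "2 - 2 * a * \<rho>\<^sup>2 + 8 * q * \<rho>\<^sup>2 * (w b)\<^sup>2 \<le> 2 - 2 * a * \<rho>\<^sup>2 + 8 * q * \<rho>\<^sup>2 * (w b)\<^sup>2 + 2 * q * (\<rho>\<^sup>2)\<^sup>2"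
      using q by simp
    also have "\<dots> = (1 - a * (\<rho>\<^sup>2 + 2 * 1 * \<rho> * w b) + q * (\<rho>\<^sup>2 + 2 * 1 * \<rho> * w b)\<^sup>2)
        + (1 - a * (\<rho>\<^sup>2 + 2 * (-1) * \<rho> * w b) + q * (\<rho>\<^sup>2 + 2 * (-1) * \<rho> * w b)\<^sup>2)"
      by (simp add: power2_eq_square algebra_simps)
    also have "\<dots> \<le> (1 + (\<rho>\<^sup>2 + 2 * 1 * \<rho> * w b)) powr (- a) + (1 + (\<rho>\<^sup>2 + 2 * (-1) * \<rho> * w b)) powr (- a)"
      by (intro add_mono low v_le b) auto
    finally show "2 - 2 * a * \<rho>\<^sup>2 + 8 * q * \<rho>\<^sup>2 * (w b)\<^sup>2 \<le> \<dots>" .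
  qed
  finally have "norm z powr (- (2 * a)) * (2 * real DIM('a) + (8 * q - 2 * a * DIM('a)) * \<rho>\<^sup>2)
     \<le> norm z powr (- (2 * a)) * (\<Sum>b\<in>Basis. (1 + (\<rho>\<^sup>2 + 2 * 1 * \<rho> * w b)) powr (- a) + (1 + (\<rho>\<^sup>2 + 2 * (-1) * \<rho> * w b)) powr (- a))"
    by (intro mult_left_mono) auto
  also have "\<dots> = (\<Sum>b\<in>Basis. norm (z + (1 * r) *\<^sub>R b) powr (- (2 * a)) + norm (z + (-1 * r) *\<^sub>R b) powr (- (2 * a)))"
    unfolding sum_distrib_left by (intro sum.cong refl) (simp only: expand insertI1 insertI2 distrib_left)
  finally show ?thesis
    by (simp add: \<rho>_def)
qed

text \<open>A sum of image multisets keeps all \<open>2 * DIM('a)\<close> points whatever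
  \<open>r\<close> is, so sizes match in an exchange.\<close>

definition cross_polytope :: "'a::euclidean_space \<Rightarrow> real \<Rightarrow> 'a multiset" where
  "cross_polytope x r =
     image_mset (\<lambda>b. x + r *\<^sub>R b) (mset_set Basis) + image_mset (\<lambda>b. x - r *\<^sub>R b) (mset_set Basis)"

lemma size_cross_polytope: "size (cross_polytope (x::'a::euclidean_space) r) = 2 * DIM('a)"
  by (simp add: cross_polytope_def)

lemma sum_mset_cross_polytope:
  "(\<Sum>x\<in>#cross_polytope x0 r. f x) = (\<Sum>b\<in>Basis. f (x0 + r *\<^sub>R b) + f (x0 - r *\<^sub>R b))"
  by (simp add: cross_polytope_def image_mset.compositionality comp_def sum.distrib flip: sum_unfold_sum_mset)

text \<open>For \<open>x = y\<close> the left side is 0, as \<open>0 powr (- s) = 0\<close>, and the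
  right side is infinite, so vertices can be estimated without separating them from
  \<open>y\<close>.\<close>

lemma ennreal_powr_le_riesz_kernel: "ennreal (norm (x - y) powr (- s)) \<le> riesz_kernel s x y"
  by (simp add: riesz_kernel_def)

text \<open>The point is uniformity: \<open>\<eta>\<close>, \<open>c\<close> and \<open>r\<close>
  are chosen before \<open>x\<^sub>0\<close>, \<open>y\<close> and \<open>\<sigma>\<close>. Half of
  the guaranteed gain pays for the points of \<open>\<sigma>\<close> not being exactly at the
  centre, the other half becomes \<open>c\<close>.\<close>

lemma cross_polytope_exchange:
  fixes \<epsilon> T s :: real
  assumes s: "s > real DIM('a::euclidean_space) - 2" "s > 0" and \<epsilon>: "\<epsilon> > 0" and T: "T > 0"
  obtains \<eta> c r where "\<eta> > 0" "c > 0"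
    "\<And>(x\<^sub>0::'a) y \<sigma>. \<lbrakk>\<epsilon> \<le> norm (x\<^sub>0 - y); norm (x\<^sub>0 - y) \<le> T; size \<sigma> = 2 * DIM('a); \<And>x. x \<in># \<sigma> \<Longrightarrow> dist x\<^sub>0 x < \<eta>\<rbrakk>
      \<Longrightarrow> (\<Sum>x\<in>#\<sigma>. riesz_kernel s x y) + ennreal c \<le> (\<Sum>x\<in>#cross_polytope x\<^sub>0 r. riesz_kernel s x y)"
proof -
  define a where "a = s / 2"
  define D where "D = real DIM('a)"
  \<comment> \<open>The midpoint of an interval that is nonempty exactly because
    \<open>s > D - 2\<close>: the lower end makes \<open>8 * q - 2 * a * D\<close> positive, the
    upper end allows the quadratic minorant.\<close>
  define q where "q = (a * D / 4 + a * (a + 1) / 2) / 2"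
  have a: "a > 0" "s = 2 * a" using s by (auto simp: a_def)
  have D: "D > 0" by (simp add: D_def)
  have "a * (D / 4) < a * ((a + 1) / 2)"
    using s a by (intro mult_strict_left_mono) (auto simp: D_def field_simps)
  then have q: "a * D / 4 < q" "q < a * (a + 1) / 2" unfolding q_def by auto
  have q0: "q \<ge> 0" using q(1) a D by (meson divide_pos_pos less_imp_le mult_pos_pos order_less_trans zero_less_numeral)
  obtain \<delta> where \<delta>: "0 < \<delta>" "\<delta> < 1" and low: "\<And>v. \<bar>v\<bar> \<le> \<delta> \<Longrightarrow> 1 - a * v + q * v\<^sup>2 \<le> (1 + v) powr (- a)"
    using neg_powr_quadratic_lower_bound[OF a(1) q(2)] by blast
  \<comment> \<open>The largest radius with \<open>3 * r \<le> \<delta> * norm z\<close> for all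
    \<open>z\<close> of norm at least \<open>\<epsilon>\<close>.\<close>
  define r where "r = \<delta> * \<epsilon> / 3"
  define g where "g = 8 * q - 2 * a * D"
  \<comment> \<open>The least relative gain, attained at the largest distance
    \<open>T\<close>.\<close>
  define \<gamma> where "\<gamma> = g * (r / T)\<^sup>2"
  have r: "r > 0" "r \<le> \<epsilon>" "3 * r = \<delta> * \<epsilon>"
    using \<delta> \<epsilon> mult_left_le_one_le[of \<epsilon> \<delta>] by (auto simp: r_def)
  have g: "g > 0" using q by (simp add: g_def mult.commute)
  have \<gamma>: "\<gamma> > 0" using g r T by (simp add: \<gamma>_def)
  \<comment> \<open>Points within \<open>\<eta>\<close> of the centre have kernels larger by a
    factor of at most \<open>(1 - \<eta> / \<epsilon>) powr (- s)\<close>; \<open>\<eta>\<close> is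
    taken so small that this costs less than \<open>\<gamma> / 2\<close>.\<close>
  have "((\<lambda>\<eta>. 2 * D * (1 - \<eta> / \<epsilon>) powr (- s)) \<longlongrightarrow> 2 * D * (1 - 0 / \<epsilon>) powr (- s)) (at_right 0)"
    using \<epsilon> by (intro tendsto_intros) auto
  then have "eventually (\<lambda>\<eta>. 2 * D * (1 - \<eta> / \<epsilon>) powr (- s) < 2 * D + \<gamma> / 2) (at_right 0)"
    using \<gamma> by (intro order_tendstoD(2)) auto
  moreover have "eventually (\<lambda>\<eta>::real. \<eta> \<in> {0<..<\<epsilon>}) (at_right 0)"
    using \<epsilon> by (rule eventually_at_right_real)
  ultimately have "eventually (\<lambda>\<eta>. 2 * D * (1 - \<eta> / \<epsilon>) powr (- s) < 2 * D + \<gamma> / 2 \<and> \<eta> \<in> {0<..<\<epsilon>}) (at_right 0)"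
    by (rule eventually_conj)
  then obtain \<eta> where \<eta>: "2 * D * (1 - \<eta> / \<epsilon>) powr (- s) < 2 * D + \<gamma> / 2" "0 < \<eta>" "\<eta> < \<epsilon>"
    by (metis (no_types, lifting) eventually_happens' greaterThanLessThan_iff trivial_limit_at_right_real)
  define k where "k = 1 - \<eta> / \<epsilon>"
  have k: "k > 0" using \<eta> \<epsilon> by (simp add: k_def)
  define c where "c = T powr (- s) * (\<gamma> / 2)"
  have c: "c > 0" using T \<gamma> by (simp add: c_def)
  have "(\<Sum>x\<in>#\<sigma>. riesz_kernel s x y) + ennreal c \<le> (\<Sum>x\<in>#cross_polytope x\<^sub>0 r. riesz_kernel s x y)"
    if lo: "\<epsilon> \<le> norm (x\<^sub>0 - y)" and hi: "norm (x\<^sub>0 - y) \<le> T" and sz: "size \<sigma> = 2 * DIM('a)"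
      and near: "\<And>x. x \<in># \<sigma> \<Longrightarrow> dist x\<^sub>0 x < \<eta>"
    for x\<^sub>0 y :: 'a and \<sigma>
  proof -
    define t where "t = norm (x\<^sub>0 - y)"
    have t: "\<epsilon> \<le> t" "t \<le> T" "t > 0" using lo hi \<epsilon> by (auto simp: t_def)
    have ker: "riesz_kernel s x y \<le> ennreal (t powr (- s) * k powr (- s))" if "x \<in># \<sigma>" for x
    proof -
      have "t - \<eta> \<le> norm (x - y)"
        using near[OF that] norm_triangle_ineq[of "x\<^sub>0 - x" "x - y"] by (simp add: t_def dist_norm)
      \<comment> \<open>Here \<open>\<epsilon> \<le> t\<close> enters: shrinking \<open>t\<close> by
        the proportion \<open>\<eta> / \<epsilon>\<close> removes at least
        \<open>\<eta>\<close>.\<close>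
      moreover have "t * k \<le> t - \<eta>"
        using t \<eta> \<epsilon> by (simp add: k_def field_simps)
      ultimately have tk: "t * k \<le> norm (x - y)" by linarith
      moreover have "0 < t * k" using t k by simp
      ultimately have "norm (x - y) powr (- s) \<le> (t * k) powr (- s)"
        using s by (intro powr_mono2') auto
      moreover have "x \<noteq> y" using tk \<open>0 < t * k\<close> by auto
      ultimately show ?thesis
        using t k by (simp add: riesz_kernel_def powr_mult ennreal_leI)
    qed
    have "(\<Sum>x\<in>#\<sigma>. riesz_kernel s x y) \<le> (\<Sum>x\<in>#\<sigma>. ennreal (t powr (- s) * k powr (- s)))"
      by (intro sum_mset_mono ker)
    also have "\<dots> = ennreal (2 * D * (t powr (- s) * k powr (- s)))"
      using sz by (simp add: D_def ennreal_mult' flip: ennreal_of_nat_eq_real_of_nat)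
    finally have "(\<Sum>x\<in>#\<sigma>. riesz_kernel s x y) + ennreal c
        \<le> ennreal (2 * D * (t powr (- s) * k powr (- s)) + c)"
      using c D by (subst ennreal_plus) (auto intro: add_right_mono)
    also have "\<dots> \<le> ennreal (\<Sum>b\<in>Basis. norm (x\<^sub>0 - y + r *\<^sub>R b) powr (- s) + norm (x\<^sub>0 - y - r *\<^sub>R b) powr (- s))"
    proof (rule ennreal_leI)
      have "c \<le> t powr (- s) * (\<gamma> / 2)"
        unfolding c_def using s t \<gamma> by (intro mult_right_mono powr_mono2') auto
      moreover have "t powr (- s) * (2 * D * k powr (- s)) \<le> t powr (- s) * (2 * D + \<gamma> / 2)"
        using \<eta> by (intro mult_left_mono) (auto simp: k_def)
      ultimately have "2 * D * (t powr (- s) * k powr (- s)) + c \<le> t powr (- s) * (2 * D + \<gamma>)"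
        by (simp add: algebra_simps)
      also have "\<dots> \<le> t powr (- s) * (2 * D + g * (r / t)\<^sup>2)"
        unfolding \<gamma>_def using t r g T
        by (intro mult_left_mono add_left_mono power_mono divide_left_mono) auto
      also have "\<dots> \<le> (\<Sum>b\<in>Basis. norm (x\<^sub>0 - y + r *\<^sub>R b) powr (- s) + norm (x\<^sub>0 - y - r *\<^sub>R b) powr (- s))"
        unfolding t_def g_def D_def a(2)
        using r t \<delta> by (intro cross_polytope_gain[where \<delta> = \<delta>] low q0) (auto simp: t_def mult_left_mono)
      finally show "2 * D * (t powr (- s) * k powr (- s)) + c \<le> \<dots>" .
    qed
    also have "\<dots> = (\<Sum>b\<in>Basis. ennreal (norm (x\<^sub>0 + r *\<^sub>R b - y) powr (- s)) + ennreal (norm (x\<^sub>0 - r *\<^sub>R b - y) powr (- s)))"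
      by (simp add: algebra_simps flip: ennreal_plus)
    also have "\<dots> \<le> (\<Sum>x\<in>#cross_polytope x\<^sub>0 r. riesz_kernel s x y)"
      unfolding sum_mset_cross_polytope by (intro sum_mono add_mono ennreal_powr_le_riesz_kernel)
    finally show ?thesis .
  qed
  with \<eta>(2) c that show thesis by blast
qed

section \<open>Counting optimal points away from \<open>A\<close>\<close>

lemma exists_submultiset_of_size:
  assumes "k \<le> size M"
  obtains S where "S \<subseteq># M" "size S = k"
proof -
  obtain xs where xs: "mset xs = M" by (metis ex_mset)
  have "M = mset (take k xs) + mset (drop k xs)"
    by (metis append_take_drop_id mset_append xs)
  then have "mset (take k xs) \<subseteq># M" by simp
  moreover have "size (mset (take k xs)) = k" using assms xs by auto
  ultimately show thesis using that by blast
qed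

lemma size_filter_mset_UN_le:
  assumes "finite I"
  shows "size {#x \<in># M. x \<in> (\<Union>i\<in>I. S i)#} \<le> (\<Sum>i\<in>I. size {#x \<in># M. x \<in> S i#})"
  using assms
proof (induction I)
  case (insert i I)
  have "size {#x \<in># M. x \<in> S i \<or> x \<in> (\<Union>i\<in>I. S i)#}
      \<le> size {#x \<in># M. x \<in> S i#} + size {#x \<in># M. x \<in> (\<Union>i\<in>I. S i)#}"
    by (induction M) auto
  with insert show ?case by simp
qed simp

lemma optimal_points_off_target_bounded:
  fixes A K :: "'a::euclidean_space set"
  assumes s: "s > real DIM('a) - 2" "s > 0"
    and A: "compact A" "A \<noteq> {}" and K: "compact K" "K \<inter> A = {}"
  obtains B where "\<And>\<omega>. \<lbrakk>max_polarization s A (size \<omega>) < \<infinity>; polarization s A \<omega> = max_polarization s A (size \<omega>)\<rbrakk>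
    \<Longrightarrow> size {#x \<in># \<omega>. x \<in> K#} \<le> B"
proof (cases "K = {}")
  case True
  with that[of 0] show thesis by simp
next
  case False
  define \<epsilon> where "\<epsilon> = setdist K A"
  have \<epsilon>: "\<epsilon> > 0"
    using A K False by (simp add: \<epsilon>_def setdist_gt_0_compact_closed compact_imp_closed)
  obtain b where b: "b > 0" "\<And>x. x \<in> K \<union> A \<Longrightarrow> norm x \<le> b"
    using A K compact_imp_bounded[of "K \<union> A"] unfolding bounded_pos by auto
  have "norm (x - y) \<le> 2 * b" if "x \<in> K" "y \<in> A" for x y
    using norm_triangle_ineq4[of x y] b(2)[of x] b(2)[of y] that by simp
  then obtain T where T: "T > 0" "\<And>x y. \<lbrakk>x \<in> K; y \<in> A\<rbrakk> \<Longrightarrow> norm (x - y) \<le> T"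
    using b(1) by (metis mult_pos_pos zero_less_numeral)
  obtain \<eta> c r where \<eta>: "\<eta> > 0" and c: "c > 0" and ex:
    "\<And>(x\<^sub>0::'a) y \<sigma>. \<lbrakk>\<epsilon> \<le> norm (x\<^sub>0 - y); norm (x\<^sub>0 - y) \<le> T; size \<sigma> = 2 * DIM('a); \<And>x. x \<in># \<sigma> \<Longrightarrow> dist x\<^sub>0 x < \<eta>\<rbrakk>
      \<Longrightarrow> (\<Sum>x\<in>#\<sigma>. riesz_kernel s x y) + ennreal c \<le> (\<Sum>x\<in>#cross_polytope x\<^sub>0 r. riesz_kernel s x y)"
    using cross_polytope_exchange[OF s \<epsilon> T(1)] by blast
  \<comment> \<open>The centres lie in \<open>K\<close>, so their distances to \<open>A\<close> stay
    between \<open>\<epsilon>\<close> and \<open>T\<close>. At most \<open>2 * DIM('a)\<close>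
    points per ball then give a bound free of the size of \<open>\<omega>\<close>.\<close>
  obtain C where C: "C \<subseteq> K" "finite C" "K \<subseteq> (\<Union>x\<in>C. ball x \<eta>)"
  proof (rule compactE_image[OF K(1), of K "\<lambda>x. ball x \<eta>"])
    show "K \<subseteq> (\<Union>x\<in>K. ball x \<eta>)" using \<eta> by auto
  qed auto
  have "size {#x \<in># \<omega>. x \<in> K#} \<le> card C * (2 * DIM('a))"
    if fin: "max_polarization s A (size \<omega>) < \<infinity>" and opt: "polarization s A \<omega> = max_polarization s A (size \<omega>)" for \<omega>
  proof -
    have ball: "size {#x \<in># \<omega>. x \<in> ball x\<^sub>0 \<eta>#} \<le> 2 * DIM('a)" if x0: "x\<^sub>0 \<in> C" for x\<^sub>0
    proof (rule ccontr)
      assume "\<not> ?thesis"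
      then obtain \<sigma> where \<sigma>: "\<sigma> \<subseteq># {#x \<in># \<omega>. x \<in> ball x\<^sub>0 \<eta>#}" "size \<sigma> = 2 * DIM('a)"
        by (metis exists_submultiset_of_size nat_le_linear)
      have near: "dist x\<^sub>0 x < \<eta>" if "x \<in># \<sigma>" for x
        using mset_subset_eqD[OF \<sigma>(1) that] by simp
      have "(\<Sum>x\<in>#\<sigma>. riesz_kernel s x y) + ennreal c \<le> (\<Sum>x\<in>#cross_polytope x\<^sub>0 r. riesz_kernel s x y)" if "y \<in> A" for y
        using x0 C(1) that \<sigma>(2) near T(2) setdist_le_dist[of x\<^sub>0 K y A]
        by (intro ex) (auto simp: \<epsilon>_def dist_norm)
      moreover have "\<sigma> \<subseteq># \<omega>"
        using \<sigma>(1) multiset_filter_subset subset_mset.order_trans by blast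
      ultimately show False
        using polarization_exchange[of \<sigma> \<omega> "cross_polytope x\<^sub>0 r" s A "ennreal c"] fin opt c \<sigma>(2)
        by (simp add: size_cross_polytope)
    qed
    have "size {#x \<in># \<omega>. x \<in> K#} \<le> size {#x \<in># \<omega>. x \<in> (\<Union>x\<in>C. ball x \<eta>)#}"
      using C(3) by (intro size_mset_mono filter_mset_mono_strong subset_mset.order_refl) (rule subsetD)
    also have "\<dots> \<le> (\<Sum>x\<in>C. size {#y \<in># \<omega>. y \<in> ball x \<eta>#})"
      using C(2) by (rule size_filter_mset_UN_le)
    also have "\<dots> \<le> (\<Sum>x\<in>C. 2 * DIM('a))"
      by (intro sum_mono ball)
    finally show ?thesis by simp
  qed
  with that show thesis by blast
qed

section \<open>Passage to the limit\<close>

lemma compactly_supported_continuousI: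
  assumes "continuous_on UNIV f" "compact K" "\<And>x. x \<notin> K \<Longrightarrow> f x = 0"
  shows "f \<in> compactly_supported_continuous"
proof -
  have "closure {x. f x \<noteq> 0} \<subseteq> K"
    using assms by (intro closure_minimal compact_imp_closed) auto
  then show ?thesis
    using assms compact_Int_closed[of K "closure {x. f x \<noteq> 0}"]
    by (auto simp: compactly_supported_continuous_def Int_absorb1)
qed

lemma abs_sum_mset_le_size_filter:
  fixes f :: "'a \<Rightarrow> real"
  assumes "\<And>x. x \<in> K \<Longrightarrow> \<bar>f x\<bar> \<le> b" "\<And>x. x \<notin> K \<Longrightarrow> f x = 0"
  shows "\<bar>\<Sum>x\<in>#M. f x\<bar> \<le> b * size {#x \<in># M. x \<in> K#}"
proof (induction M)
  case (add x M)
  have "\<bar>f x + (\<Sum>x\<in>#M. f x)\<bar> \<le> \<bar>f x\<bar> + \<bar>\<Sum>x\<in>#M. f x\<bar>"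
    by (rule abs_triangle_ineq)
  with add assms[of x] show ?case
    by (cases "x \<in> K") (auto simp: algebra_simps)
qed simp

text \<open>At most \<open>B\<close> points contribute to the integral, each at most a constant
  divided by \<open>N\<close>.\<close>

lemma integral_normalized_counting_measure_tendsto_0:
  fixes f :: "'a::euclidean_space \<Rightarrow> real"
  assumes size: "\<And>N. N \<ge> 1 \<Longrightarrow> size (\<omega> N) = N"
    and bound: "\<And>N. N \<ge> 1 \<Longrightarrow> size {#x \<in># \<omega> N. x \<in> K#} \<le> B"
    and K: "compact K" and f: "continuous_on UNIV f" and supp: "\<And>x. x \<notin> K \<Longrightarrow> f x = 0"
  shows "(\<lambda>N. \<integral>x. f x \<partial>normalized_counting_measure (\<omega> N)) \<longlonglongrightarrow> 0"
proof -
  have "bounded (f ` K)"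
    using K f by (intro compact_imp_bounded compact_continuous_image) (auto intro: continuous_on_subset)
  then obtain b where b: "b > 0" "\<And>x. x \<in> K \<Longrightarrow> \<bar>f x\<bar> \<le> b"
    by (auto simp: bounded_pos)
  have "\<forall>\<^sub>F N in sequentially. norm (\<integral>x. f x \<partial>normalized_counting_measure (\<omega> N)) \<le> b * B / real N"
    using eventually_ge_at_top[of 1]
  proof eventually_elim
    case (elim N)
    have "(\<integral>x. f x \<partial>normalized_counting_measure (\<omega> N)) = (\<Sum>x\<in>#\<omega> N. f x) / N"
      using elim size[OF elim] f
      by (subst integral_normalized_counting_measure) (auto intro: borel_measurable_continuous_onI)
    moreover have "\<bar>\<Sum>x\<in>#\<omega> N. f x\<bar> \<le> b * B"
      using abs_sum_mset_le_size_filter[of K f b "\<omega> N"] b supp bound[OF elim]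
      by (smt (verit, best) mult_left_mono of_nat_mono)
    ultimately show ?case
      using elim by (simp add: divide_right_mono)
  qed
  then show ?thesis
    by (rule Lim_null_comparison) real_asymp
qed

theorem corollary1p9:
  fixes s :: real
    and A :: "(real ^ 'n) set"
    and \<omega> :: "nat \<Rightarrow> (real ^ 'n) multiset"
    and \<mu> :: "(real ^ 'n) measure"
  assumes "CARD('n) \<ge> 2"
    and "s > real CARD('n) - 2"
    and "compact A"
    and "A \<noteq> {}"
    and "\<And>N. N \<ge> 1 \<Longrightarrow> max_polarization s A N < \<infinity>"
    and "\<And>N. N \<ge> 1 \<Longrightarrow> size (\<omega> N) = N"
    and "\<And>N. N \<ge> 1 \<Longrightarrow> polarization s A (\<omega> N) = max_polarization s A N"
    and "cluster_point_in weak_star_topology (\<lambda>N. normalized_counting_measure (\<omega> N)) \<mu>"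
  shows "prob_space \<mu> \<and> emeasure \<mu> (- A) = 0"
proof -
  let ?\<nu> = "\<lambda>N. normalized_counting_measure (\<omega> N)"
  have s: "s > real DIM(real ^ 'n) - 2" "s > 0"
    using assms(1,2) by auto
  have opt: "max_polarization s A (size (\<omega> N)) < \<infinity>"
    "polarization s A (\<omega> N) = max_polarization s A (size (\<omega> N))" if "N \<ge> 1" for N
    using assms(5-7) that by simp_all
  have \<mu>: "\<mu> \<in> radon_measures"
    using assms(8) by (simp add: cluster_point_in_def)
  then have sets: "sets \<mu> = sets borel" and space: "space \<mu> = UNIV"
    using sets_eq_imp_space_eq[of \<mu> borel] by (auto simp: radon_measures_def)

  \<comment> \<open>Nonnegative test functions on compact sets disjoint from \<open>A\<close>;
    jointly they are positive at every point off \<open>A\<close>.\<close>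
  define f where "f = (\<lambda>m (x :: real ^ 'n). max 0 (1 - norm x / Suc m) * max 0 (infdist x A - 1 / Suc m))"
  have "AE x in \<mu>. f m x = 0" for m
  proof -
    define K where "K = cball 0 (real (Suc m)) \<inter> {x. 1 / real (Suc m) \<le> infdist x A}"
    have "closed {x. 1 / real (Suc m) \<le> infdist x A}"
      by (intro closed_Collect_le continuous_intros)
    then have K: "compact K" unfolding K_def by (intro compact_Int_closed) auto
    have "K \<inter> A = {}" by (auto simp: K_def)
    then obtain B where "\<And>N. N \<ge> 1 \<Longrightarrow> size {#x \<in># \<omega> N. x \<in> K#} \<le> B"
      using optimal_points_off_target_bounded[OF s assms(3,4) K] opt by metis
    moreover have cont: "continuous_on UNIV (f m)"
      unfolding f_def by (intro continuous_intros) auto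
    moreover have supp: "f m x = 0" if "x \<notin> K" for x
      using that by (auto simp: f_def K_def max_def field_simps)
    ultimately have "(\<lambda>N. \<integral>x. f m x \<partial>?\<nu> N) \<longlonglongrightarrow> 0"
      using assms(6) K by (intro integral_normalized_counting_measure_tendsto_0) auto
    moreover have Cc: "f m \<in> compactly_supported_continuous"
      using cont K supp by (rule compactly_supported_continuousI)
    ultimately have "(\<integral>x. f m x \<partial>\<mu>) = 0"
      using cluster_point_in_weak_star_integral assms(8) by blast
    moreover have "AE x in \<mu>. 0 \<le> f m x" by (simp add: f_def)
    \<comment> \<open>Integrability excludes the default integral 0 of a non-integrable
      function.\<close>
    ultimately show ?thesis
      using integral_nonneg_eq_0_iff_AE integrable_compactly_supported_continuous[OF \<mu> Cc] by blast
  qed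
  then have "AE x in \<mu>. \<forall>m. f m x = 0"
    by (simp add: AE_all_countable)
  then have AE_A: "AE x in \<mu>. x \<in> A"
  proof eventually_elim
    case (elim x)
    show ?case
    proof (rule ccontr)
      assume "x \<notin> A"
      then have pos: "infdist x A > 0"
        using assms(3,4) in_closed_iff_infdist_zero[of A x] infdist_nonneg[of x A]
        by (auto simp: compact_imp_closed less_le)
      have "\<forall>\<^sub>F m in sequentially. 1 / real (Suc m) < infdist x A \<and> norm x < real (Suc m)"
        using pos by (intro eventually_conj; real_asymp)
      then obtain m where "1 / real (Suc m) < infdist x A" "norm x < real (Suc m)"
        by (auto simp: eventually_sequentially)
      then have "f m x > 0"
        unfolding f_def by (intro mult_pos_pos) (auto simp: divide_less_eq)
      with elim show False by simp
    qed
  qed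
  have null: "emeasure \<mu> (- A) = 0"
    using AE_A sets space assms(3)
    by (subst (asm) AE_iff_measurable[where N = "- A"]) (auto simp: compact_imp_closed)

  obtain R where R: "R > 0" "\<And>y. y \<in> A \<Longrightarrow> norm y \<le> R"
    using compact_imp_bounded[OF assms(3)] unfolding bounded_pos by auto
  \<comment> \<open>A cut-off equal to 1 on the ball that contains both \<open>A\<close> and all
    optimal points, so testing against it records the whole mass and none can escape.\<close>
  define h where "h = (\<lambda>x :: real ^ 'n. max 0 (min 1 (3 * R + 1 - norm x)))"
  have cont: "continuous_on UNIV h"
    unfolding h_def by (intro continuous_intros)
  have Cc: "h \<in> compactly_supported_continuous"
    by (rule compactly_supported_continuousI[OF cont compact_cball[of 0 "3 * R + 1"]])
      (auto simp: h_def)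
  have h1: "h x = 1" if "norm x \<le> 3 * R" for x
    using that by (simp add: h_def)
  have "(\<integral>x. h x \<partial>?\<nu> N) = 1" if "N \<ge> 1" for N
  proof -
    have "h x = 1" if "x \<in># \<omega> N" for x
      using optimal_points_bounded[OF s(2) R opt[OF \<open>N \<ge> 1\<close>] that] h1 by blast
    then have "(\<Sum>x\<in>#\<omega> N. h x) = (\<Sum>x\<in>#\<omega> N. 1)"
      by (intro arg_cong[where f = sum_mset] image_mset_cong) auto
    then have "(\<Sum>x\<in>#\<omega> N. h x) = N"
      using assms(6)[OF that] by simp
    then show ?thesis
      using that assms(6)[OF that] cont
      by (subst integral_normalized_counting_measure) (auto intro: borel_measurable_continuous_onI)
  qed
  then have "(\<lambda>N. \<integral>x. h x \<partial>?\<nu> N) \<longlonglongrightarrow> 1"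
    by (intro tendsto_eventually eventually_sequentiallyI)
  then have "(\<integral>x. h x \<partial>\<mu>) = 1"
    using cluster_point_in_weak_star_integral[OF assms(8) Cc] by blast
  moreover have "(\<integral>x. h x \<partial>\<mu>) = (\<integral>x. 1 \<partial>\<mu>)"
  proof (rule integral_cong_AE)
    show "AE x in \<mu>. h x = 1"
      using AE_A by eventually_elim (use R h1 in force)
    show "h \<in> borel_measurable \<mu>"
      using borel_measurable_continuous_onI[OF cont] sets measurable_cong_sets by blast
  qed simp
  ultimately have "measure \<mu> (space \<mu>) = 1"
    by simp
  \<comment> \<open>\<open>measure\<close> is 0 on sets of infinite mass, so the value 1 also shows
    that the mass is finite.\<close>
  then have "emeasure \<mu> (space \<mu>) = 1"
    by (metis emeasure_eq_ennreal_measure ennreal_1 measure_zero_top zero_neq_one)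
  with null show ?thesis
    by (simp add: prob_spaceI)
qed

end
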